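(* Let $e$ be a finite set, $K>0$, and let $g_e$ be either $g_e(S)=\min(|S|,K)$ or $g_e(S)=\min(|S|,|e\setminus S|,K)$ on $2^e$. Then any $1.1$-approximation of $g_e$ (i.e., $g_e$ being $(1+0.1)$-approximable with support size $p$) must have support size $p\ge\Omega(|e|/K)$.
   Context: A function $g_e:2^e\to\mathbb{R}_{\ge0}$ is $(1+\epsilon)$-approximable with support size $p$ if there are sets $e_1,\dots,e_r\subseteq e$ with $|e_i|\le p$ and submodular functions $g_{e_i}:2^{e_i}\to\mathbb{R}_{\ge0}$ such that $\sum_{i=1}^r g_{e_i}(S\cap e_i)\in[(1-\epsilon)g_e(S),(1+\epsilon)g_e(S)]$ for all $S\subseteq e$. $\Omega(\cdot)$ hides an absolute constant.
   Formalization: K is taken to be a real number with K ≥ 1 (for K → 0 the claim fails, since p = |e| always suffices), and for the second function with |e| = 1, where g_e is identically zero, p ≥ 1 is required. *)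

theory Defs imports Complex_Main begin

definition submodular_on :: "'a set \<Rightarrow> ('a set \<Rightarrow> real) \<Rightarrow> bool" where
  "submodular_on E f \<longleftrightarrow>
     (\<forall>A B. A \<subseteq> E \<longrightarrow> B \<subseteq> E \<longrightarrow> f (A \<union> B) + f (A \<inter> B) \<le> f A + f B)"

text \<open>
  A function on the power set of \<open>E\<close> is a total function on sets of which only the values on
  subsets of \<open>E\<close> are used. In the following definition \<open>d i\<close> and \<open>h i\<close> (for \<open>i = 1, \<dots>, r\<close>) are
  the support sets and the functions on them; \<open>r = 0\<close> is allowed and gives the zero sum.
\<close>

definition approximable :: "real \<Rightarrow> nat \<Rightarrow> 'a set \<Rightarrow> ('a set \<Rightarrow> real) \<Rightarrow> bool" where
  "approximable \<epsilon> p e g \<longleftrightarrow>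
     (\<exists>(r::nat) (d :: nat \<Rightarrow> 'a set) (h :: nat \<Rightarrow> 'a set \<Rightarrow> real).
        (\<forall>i\<in>{1..r}. d i \<subseteq> e \<and> finite (d i) \<and> card (d i) \<le> p
                    \<and> (\<forall>S. S \<subseteq> d i \<longrightarrow> 0 \<le> h i S)
                    \<and> submodular_on (d i) (h i))
      \<and> (\<forall>S. S \<subseteq> e \<longrightarrow>
            (\<Sum>i=1..r. h i (S \<inter> d i)) \<in> {(1 - \<epsilon>) * g S .. (1 + \<epsilon>) * g S}))"

end

theory Submission imports Defs begin

text \<open>
  Let \<open>F S\<close> be the approximating sum. For a set \<open>S\<close> of about \<open>2 K\<close> elements, \<open>F S\<close> is at most
  \<open>1.1 K\<close>, whereas the values of \<open>F\<close> on the singletons of \<open>S\<close> sum to at least \<open>1.8 K\<close>. Since the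
  summands are nonnegative, this loss is bounded by the weight of the pairs of elements of \<open>S\<close> lying
  in a common support set. The total weight of all pairs of elements of \<open>e\<close> is \<open>O(p |e|)\<close>, and an
  averaging argument yields an \<open>S\<close> receiving at most its proportional share \<open>O(p K\<^sup>2 / |e|)\<close>.
  Hence \<open>p K\<^sup>2 / |e|\<close> is at least a constant times \<open>K\<close>.
\<close>

text \<open>Elements are deleted one at a time. An ordered pair of distinct elements survives
  \<open>n - 2\<close> of the \<open>n\<close> possible deletions, so some deletion leaves at most
  the fraction \<open>(n - 2) / n\<close> of the weight. These fractions telescope to
  \<open>m (m - 1) / (n (n - 1))\<close>.\<close>

lemma ex_subset_pair_weight_le:
  fixes w :: "'a \<Rightarrow> 'a \<Rightarrow> real"
  assumes "finite T" and "m \<le> card T" and diag: "\<And>x. w x x = 0"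
  shows "\<exists>S\<subseteq>T. card S = m \<and>
    (\<Sum>u\<in>S. \<Sum>v\<in>S. w u v) * (real (card T) * (real (card T) - 1))
      \<le> (\<Sum>u\<in>T. \<Sum>v\<in>T. w u v) * (real m * (real m - 1))"
  using assms(1,2)
proof (induction "card T" arbitrary: T rule: less_induct)
  case less
  define W where "W S = (\<Sum>u\<in>S. \<Sum>v\<in>S. w u v)" for S
  define n where "n = real (card T)"
  consider "m = card T" | "m < card T" "m \<le> 1" | "m < card T" "2 \<le> m"
    using less.prems by linarith
  then show ?case
  proof cases
    case 1
    then show ?thesis by blast
  next
    \<comment> \<open>Split off because \<open>n = 2\<close> is possible here, and then the factor
      \<open>n - 2\<close> cannot be cancelled. With at most one element in \<open>S\<close>, both
      sides vanish.\<close>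
    case 2
    obtain S where S: "S \<subseteq> T" "card S = m"
      using obtain_subset_with_card_n[OF less.prems(2)] by metis
    have "finite S" using S(1) less.prems(1) finite_subset by blast
    then have "S = {} \<or> (\<exists>x. S = {x})"
      using S(2) 2 by (metis One_nat_def card_0_eq card_1_singletonE le_Suc_eq le_zero_eq)
    then have "(\<Sum>u\<in>S. \<Sum>v\<in>S. w u v) = 0" by (auto simp: diag)
    moreover have "real m * (real m - 1) = 0" using 2 by (cases m) auto
    ultimately show ?thesis using S by (intro exI[of _ S]) (simp only: mult_zero_left mult_zero_right simp_thms order_refl)
  next
    case 3
    then have n3: "n \<ge> 3" by (simp add: n_def)
    \<comment> \<open>Row and column of \<open>x\<close> are removed; their common entry
      \<open>w x x\<close> is 0, so subtracting it twice does no harm.\<close>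
    have del: "W (T - {x}) = W T - (\<Sum>u\<in>T. w u x) - (\<Sum>v\<in>T. w x v)" if "x \<in> T" for x
      using that less.prems(1) by (simp add: W_def sum_diff1 sum_subtractf diag)
    have "(\<Sum>x\<in>T. W (T - {x})) = (\<Sum>x\<in>T. W T - (\<Sum>u\<in>T. w u x) - (\<Sum>v\<in>T. w x v))"
      by (rule sum.cong) (auto simp: del)
    also have "\<dots> = n * W T - (\<Sum>x\<in>T. \<Sum>u\<in>T. w u x) - W T"
      by (simp add: sum_subtractf n_def W_def)
    also have "(\<Sum>x\<in>T. \<Sum>u\<in>T. w u x) = W T"
      unfolding W_def by (rule sum.swap)
    finally have tot: "(\<Sum>x\<in>T. W (T - {x})) = W T * (n - 2)"
      by (simp add: algebra_simps)
    have "\<exists>x\<in>T. n * W (T - {x}) \<le> W T * (n - 2)"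
    proof (rule ccontr)
      assume "\<not> ?thesis"
      then have "(\<Sum>x\<in>T. W T * (n - 2)) < (\<Sum>x\<in>T. n * W (T - {x}))"
        using 3 less.prems(1) by (intro sum_strict_mono) auto
      then show False
        by (simp add: sum_distrib_left[symmetric] tot n_def)
    qed
    then obtain x where x: "x \<in> T" "n * W (T - {x}) \<le> W T * (n - 2)" by blast
    have c: "card (T - {x}) = card T - 1" using x less.prems by simp
    then have cn: "real (card (T - {x})) = n - 1" using 3 by (simp add: n_def)
    obtain S where S: "S \<subseteq> T - {x}" "card S = m"
      "W S * ((n - 1) * (n - 1 - 1)) \<le> W (T - {x}) * (real m * (real m - 1))"
    proof -
      have "card (T - {x}) < card T" "finite (T - {x})" "m \<le> card (T - {x})"
        using 3 less.prems(1) c by auto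
      from less.hyps[OF this] show thesis
        unfolding cn W_def[symmetric] using that by blast
    qed
    have "(W S * (n * (n - 1))) * (n - 2) = n * (W S * ((n - 1) * (n - 1 - 1)))"
      by (simp add: algebra_simps)
    also have "\<dots> \<le> n * (W (T - {x}) * (real m * (real m - 1)))"
      using S(3) n3 by (intro mult_left_mono) auto
    also have "\<dots> = (n * W (T - {x})) * (real m * (real m - 1))" by simp
    also have "\<dots> \<le> (W T * (n - 2)) * (real m * (real m - 1))"
      using x(2) 3 by (intro mult_right_mono) auto
    also have "\<dots> = (W T * (real m * (real m - 1))) * (n - 2)" by simp
    finally have "W S * (n * (n - 1)) \<le> W T * (real m * (real m - 1))"
      using n3 by simp
    then show ?thesis using S(1,2) unfolding W_def n_def by blast
  qed
qed

text \<open>Each \<open>u\<close> in \<open>S \<inter> d\<close> has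
  \<open>card (S \<inter> d) - 1\<close> partners. If \<open>S \<inter> d\<close> is empty, the
  factor is -1 but the sum is 0.\<close>

lemma sum_pairs_in_set:
  fixes a :: "'a \<Rightarrow> real"
  assumes "finite S"
  shows "(\<Sum>u\<in>S. \<Sum>v\<in>S. if u \<noteq> v \<and> u \<in> d \<and> v \<in> d then a u else 0)
    = (real (card (S \<inter> d)) - 1) * (\<Sum>u\<in>S \<inter> d. a u)"
proof -
  have inner: "(\<Sum>v\<in>S. if u \<noteq> v \<and> u \<in> d \<and> v \<in> d then a u else 0)
      = (if u \<in> d then (real (card (S \<inter> d)) - 1) * a u else 0)" if "u \<in> S" for u
  proof (cases "u \<in> d")
    case True
    have "(\<Sum>v\<in>S. if u \<noteq> v \<and> u \<in> d \<and> v \<in> d then a u else 0)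
        = (\<Sum>v\<in>(S \<inter> d) - {u}. a u)"
      using True assms by (intro sum.mono_neutral_cong_right) auto
    also have "\<dots> = real (card (S \<inter> d) - 1) * a u"
      using True that assms by simp
    also have "real (card (S \<inter> d) - 1) = real (card (S \<inter> d)) - 1"
    proof -
      have "card (S \<inter> d) > 0" using True that assms by (auto simp: card_gt_0_iff)
      then show ?thesis by simp
    qed
    finally show ?thesis using True by simp
  qed simp
  show ?thesis
    using assms by (simp add: inner sum.inter_restrict sum_distrib_left if_distrib cong: if_cong)
qed

text \<open>With \<open>k = card (S \<inter> d)\<close>, the left side is \<open>2 - k\<close> times
  the sum of the singleton values. For \<open>k \<le> 1\<close> it equals
  \<open>h (S \<inter> d)\<close>; for \<open>k \<ge> 2\<close> it is at most 0.\<close>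

lemma singleton_sum_minus_pairs_le:
  fixes h :: "'a set \<Rightarrow> real"
  assumes "finite S" and nonneg: "\<And>A. A \<subseteq> d \<Longrightarrow> 0 \<le> h A" and empty: "h {} = 0"
  shows "(\<Sum>u\<in>S. h ({u} \<inter> d))
      - (\<Sum>u\<in>S. \<Sum>v\<in>S. if u \<noteq> v \<and> u \<in> d \<and> v \<in> d then h {u} else 0) \<le> h (S \<inter> d)"
proof -
  have "(\<Sum>u\<in>S. h ({u} \<inter> d)) = (\<Sum>u\<in>S \<inter> d. h {u})"
    using assms(1) by (intro sum.mono_neutral_cong_right) (auto simp: empty)
  then have eq: "(\<Sum>u\<in>S. h ({u} \<inter> d))
      - (\<Sum>u\<in>S. \<Sum>v\<in>S. if u \<noteq> v \<and> u \<in> d \<and> v \<in> d then h {u} else 0)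
      = (2 - real (card (S \<inter> d))) * (\<Sum>u\<in>S \<inter> d. h {u})"
    by (simp add: sum_pairs_in_set[OF assms(1)] algebra_simps)
  consider "S \<inter> d = {}" | x where "S \<inter> d = {x}" | "card (S \<inter> d) \<ge> 2"
  proof -
    have "card (S \<inter> d) = 0 \<or> card (S \<inter> d) = 1 \<or> card (S \<inter> d) \<ge> 2" by linarith
    then show thesis
      using that assms(1) by (metis card_0_eq card_1_singletonE finite_Int)
  qed
  then show ?thesis
  proof cases
    case 3
    then have "(2 - real (card (S \<inter> d))) * (\<Sum>u\<in>S \<inter> d. h {u}) \<le> 0"
      by (intro mult_nonpos_nonneg sum_nonneg nonneg) auto
    then show ?thesis using eq nonneg[of "S \<inter> d"] by simp
  qed (simp_all add: eq empty)
qed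

text \<open>The assumptions on \<open>g\<close> collect what both functions of the theorem share:
  value 0 at the empty set, value 1 at singletons, and the cap \<open>K\<close>.\<close>

lemma approximable_support_size_ge:
  fixes g :: "'a set \<Rightarrow> real"
  assumes fin: "finite e" and ne: "e \<noteq> {}" and K: "K \<ge> 1"
    and g0: "g {} = 0" and g1: "\<And>v. v \<in> e \<Longrightarrow> g {v} = 1" and gK: "\<And>S. S \<subseteq> e \<Longrightarrow> g S \<le> K"
    and appr: "approximable (1/10) p e g"
  shows "real p \<ge> 1/20 * (real (card e) / K)"
proof -
  obtain r :: nat and d h where
    dh: "\<forall>i\<in>{1..r}. d i \<subseteq> e \<and> finite (d i) \<and> card (d i) \<le> p
        \<and> (\<forall>S. S \<subseteq> d i \<longrightarrow> 0 \<le> h i S) \<and> submodular_on (d i) (h i)"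
    and bd: "\<forall>S. S \<subseteq> e \<longrightarrow>
        (\<Sum>i=1..r. h i (S \<inter> d i)) \<in> {(1 - 1/10) * g S .. (1 + 1/10) * g S}"
    using appr unfolding approximable_def by (elim exE conjE)
  note dh = bspec[OF dh] and bd = bd[rule_format]
  define F where "F S = (\<Sum>i=1..r. h i (S \<inter> d i))" for S
  define n where "n = real (card e)"
  have F1: "9/10 \<le> F {v}" "F {v} \<le> 11/10" if "v \<in> e" for v
    using bd[of "{v}"] that g1[OF that] by (auto simp: F_def)
  have FK: "F S \<le> 11/10 * K" if "S \<subseteq> e" for S
    using bd[OF that] gK[OF that] by (auto simp: F_def)
  have F0: "F {} = 0" using bd[of "{}"] g0 by (auto simp: F_def)
  have h0: "h i {} = 0" if "i \<in> {1..r}" for i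
  proof -
    have "\<forall>i\<in>{1..r}. h i {} = 0"
      using F0 dh by (subst sum_nonneg_eq_0_iff[symmetric]) (auto simp: F_def)
    then show ?thesis using that by blast
  qed
  \<comment> \<open>If \<open>p = 0\<close>, all supports are empty and \<open>F\<close> is
    constant, contradicting \<open>F {} = 0\<close> and \<open>F {v} \<ge> 9/10\<close>.\<close>
  have p1: "real p \<ge> 1"
  proof (rule ccontr)
    assume "\<not> ?thesis"
    then have "d i = {}" if "i \<in> {1..r}" for i
      using dh[OF that] by (metis One_nat_def card_0_eq le_zero_eq not_less_eq_eq of_nat_1 of_nat_mono)
    then have "F S = F {}" for S unfolding F_def by (intro sum.cong) auto
    then show False using F0 F1(1) ne by fastforce
  qed
  show ?thesis
  \<comment> \<open>Beyond this threshold, \<open>m \<le> 2 K + 1 \<le> 3 K < n\<close>, so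
    \<open>e\<close> has a subset of size \<open>m\<close>. Below it, \<open>p \<ge> 1\<close>
    suffices.\<close>
  proof (cases "n \<le> 3 * K")
    case True
    then have "n / K \<le> 3" using K by (simp add: field_simps)
    then show ?thesis using p1 by (simp add: n_def)
  next
    case False
    define m where "m = nat \<lceil>2 * K\<rceil>"
    have m: "real m \<ge> 2 * K" "real m \<le> 2 * K + 1"
      using K unfolding m_def by linarith+
    have mn: "m \<le> card e" using m False K by (simp add: n_def)
    \<comment> \<open>An ordered pair is charged the singleton value of its first element, once for
      each support set containing both. Thus the charges to a fixed \<open>u\<close> total at most
      \<open>p\<close> times \<open>F {u}\<close>.\<close>
    define w where "w u v = (\<Sum>i=1..r. if u \<noteq> v \<and> u \<in> d i \<and> v \<in> d i then h i {u} else 0)" for u v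
    define W where "W S = (\<Sum>u\<in>S. \<Sum>v\<in>S. w u v)" for S
    have W: "W S = (\<Sum>i=1..r. \<Sum>u\<in>S. \<Sum>v\<in>S. if u \<noteq> v \<and> u \<in> d i \<and> v \<in> d i then h i {u} else 0)" for S
      unfolding W_def w_def by (rule trans[OF sum.cong[OF refl sum.swap] sum.swap])
    have low: "9/10 * real (card S) - W S \<le> F S" if "S \<subseteq> e" for S
    proof -
      have "finite S" using that fin finite_subset by blast
      have "9/10 * real (card S) = (\<Sum>u\<in>S. 9/10)" by simp
      also have "\<dots> \<le> (\<Sum>u\<in>S. F {u})" using that F1 by (intro sum_mono) auto
      also have "\<dots> = (\<Sum>i=1..r. \<Sum>u\<in>S. h i ({u} \<inter> d i))" unfolding F_def by (rule sum.swap)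
      finally have "9/10 * real (card S) - W S \<le> (\<Sum>i=1..r. (\<Sum>u\<in>S. h i ({u} \<inter> d i))
          - (\<Sum>u\<in>S. \<Sum>v\<in>S. if u \<noteq> v \<and> u \<in> d i \<and> v \<in> d i then h i {u} else 0))"
        by (simp add: W sum_subtractf)
      also have "\<dots> \<le> F S"
        unfolding F_def using dh h0 \<open>finite S\<close>
        by (intro sum_mono singleton_sum_minus_pairs_le) auto
      finally show ?thesis .
    qed
    have We: "W e \<le> real p * (11/10 * n)"
    proof -
      have "W e \<le> (\<Sum>i=1..r. real p * (\<Sum>u\<in>e. h i ({u} \<inter> d i)))"
        unfolding W
      proof (rule sum_mono)
        fix i assume i: "i \<in> {1..r}"
        have "e \<inter> d i = d i" using dh[OF i] by blast
        moreover have "(\<Sum>u\<in>e. h i ({u} \<inter> d i)) = (\<Sum>u\<in>d i. h i {u})"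
          using dh[OF i] fin h0[OF i] by (intro sum.mono_neutral_cong_right) auto
        moreover have "(real (card (d i)) - 1) * (\<Sum>u\<in>d i. h i {u}) \<le> real p * (\<Sum>u\<in>d i. h i {u})"
          using dh[OF i] by (intro mult_right_mono sum_nonneg) auto
        ultimately show "(\<Sum>u\<in>e. \<Sum>v\<in>e. if u \<noteq> v \<and> u \<in> d i \<and> v \<in> d i then h i {u} else 0)
            \<le> real p * (\<Sum>u\<in>e. h i ({u} \<inter> d i))"
          by (simp add: sum_pairs_in_set[OF fin])
      qed
      also have "\<dots> = real p * (\<Sum>u\<in>e. F {u})"
        unfolding F_def sum_distrib_left[symmetric] by (rule arg_cong[OF sum.swap])
      also have "\<dots> \<le> real p * (\<Sum>u\<in>e. 11/10)"
        using F1 by (intro mult_left_mono sum_mono) auto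
      finally show ?thesis by (simp add: n_def mult.commute)
    qed
    obtain S where S: "S \<subseteq> e" "card S = m"
      "W S * (n * (n - 1)) \<le> W e * (real m * (real m - 1))"
      using ex_subset_pair_weight_le[OF fin mn, of w] unfolding W_def n_def
      by (auto simp: w_def)
    have n3: "n > 3" using False K by linarith
    \<comment> \<open>As \<open>K \<le> m / 2\<close>, the cap gives
      \<open>F S \<le> 11/20 m\<close>, and \<open>9/10 - 11/20 = 7/20\<close>.\<close>
    have "7/20 * real m \<le> W S"
      using low[OF S(1)] FK[OF S(1)] S(2) m by linarith
    then have "7/20 * real m * (n * (n - 1)) \<le> W S * (n * (n - 1))"
      using n3 by (intro mult_right_mono) auto
    also note S(3)
    also have "W e * (real m * (real m - 1)) \<le> real p * (11/10 * n) * (real m * (real m - 1))"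
      using We m K by (intro mult_right_mono) auto
    finally have "(7/20 * (n - 1)) * (n * real m) \<le> (11/10 * real p * (real m - 1)) * (n * real m)"
      by (simp add: algebra_simps)
    then have "7/20 * (n - 1) \<le> 11/10 * real p * (real m - 1)"
      by (rule mult_right_le_imp_le) (use n3 m K in auto)
    \<comment> \<open>Rounding up costs less than one element, so
      \<open>m - 1 \<le> 2 K\<close>.\<close>
    also have "\<dots> \<le> 11/10 * real p * (2 * K)"
      using m by (intro mult_left_mono) auto
    finally have "7/20 * (n - 1) \<le> 11/5 * (real p * K)" by (simp add: mult.commute)
    \<comment> \<open>From \<open>n > 3\<close>, \<open>n - 1 > 2/3 n\<close>; this gives the
      constant \<open>66/7\<close>, which is below 20.\<close>
    moreover have "n \<le> 20 * x" if "7/20 * (n - 1) \<le> 11/5 * x" for x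
      using that n3 by (simp add: field_simps)
    ultimately have "n \<le> 20 * (real p * K)" by blast
    then show ?thesis using K by (simp add: n_def field_simps)
  qed
qed

theorem theorem6:
  "\<exists>c::real. c > 0 \<and>
     (\<forall>(e :: 'a set) (K :: real) (g :: 'a set \<Rightarrow> real) (p :: nat).
        finite e \<longrightarrow> K \<ge> 1 \<longrightarrow>
        (\<forall>S. S \<subseteq> e \<longrightarrow> g S = min (real (card S)) K) \<or>
        (\<forall>S. S \<subseteq> e \<longrightarrow> g S = min (min (real (card S)) (real (card (e - S)))) K) \<and>
          (card e = 1 \<longrightarrow> p \<ge> 1) \<longrightarrow>
        approximable (1/10) p e g \<longrightarrow>
        real p \<ge> c * (real (card e) / K))"
proof (intro exI[of _ "1/20"] conjI allI impI)
  fix e :: "'a set" and K :: real and g :: "'a set \<Rightarrow> real" and p :: nat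
  assume fin: "finite e" and K: "K \<ge> 1" and appr: "approximable (1/10) p e g"
  assume "(\<forall>S. S \<subseteq> e \<longrightarrow> g S = min (real (card S)) K) \<or>
        (\<forall>S. S \<subseteq> e \<longrightarrow> g S = min (min (real (card S)) (real (card (e - S)))) K) \<and>
          (card e = 1 \<longrightarrow> p \<ge> 1)" (is "?A \<or> ?B \<and> ?C")
  \<comment> \<open>For a one-element \<open>e\<close> the second function is identically 0, so that
    case rests on \<open>p \<ge> 1\<close>. From two elements on, complements of singletons are
    nonempty and singletons have value 1.\<close>
  then consider "e = {}" | "e \<noteq> {}" ?A | "card e = 1" "p \<ge> 1" | "card e \<ge> 2" ?B
    using fin by (metis One_nat_def Suc_1 card_0_eq not_less_eq_eq le_Suc_eq le_zero_eq)
  then show "real p \<ge> 1/20 * (real (card e) / K)"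
  proof cases
    case 2
    then show ?thesis
      using K by (intro approximable_support_size_ge[OF fin _ K _ _ _ appr]) auto
  next
    case 3
    have "1/20 * (real (card e) / K) \<le> 1" using 3 K by (simp add: field_simps)
    then show ?thesis using 3 by linarith
  next
    case 4
    then have "e \<noteq> {}" by auto
    then show ?thesis
      using K 4 fin by (intro approximable_support_size_ge[OF fin _ K _ _ _ appr]) (auto simp: min_def)
  qed simp
qed simp

end
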